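(* Let $n\ge1$ and $d,k\ge0$. There is a bijection between the set of bi-increasing permutations $\pi\in{\cal S}_n$ with ${\sf des}(\pi)=d$ and ${\sf ddes}(\pi)=k$ and the set of $2$-Motzkin paths of length $n$ that have exactly $d$ up-steps, have no broken step of height $0$, and for which the sum of the heights of all steps equals $k$.
   Context: Permutations $\pi\in{\cal S}_n$ are written as words $\pi_1\cdots\pi_n$. An excedance of $\pi$ is an integer $i\in[n-1]$ with $\pi_i>i$; ${\sf E}(\pi)$ is the set of excedances, ${\sf dexc}(\pi)=\sum_{i\in{\sf E}(\pi)}(\pi_i-i)$, and ${\sf inv}(\pi)$ is the number of pairs $i<j$ with $\pi_i>\pi_j$. A permutation is bi-increasing if ${\sf inv}(\pi)={\sf dexc}(\pi)$. A descent is an $i\in[n-1]$ with $\pi_i>\pi_{i+1}$; ${\sf D}(\pi)$ is the set of descents, ${\sf des}(\pi)=|{\sf D}(\pi)|$ and ${\sf ddes}(\pi)=\sum_{i\in{\sf D}(\pi)}(\pi_i-\pi_{i+1})$. A $2$-Motzkin path of length $n$ is a lattice path from $(0,0)$ to $(n,0)$ never going below the $x$-axis, each step being an up-step $[1,1]$, a down-step $[1,-1]$, or one of two distinguishable kinds of horizontal step $[1,0]$, called solid and broken. The height of a step is the ordinate of its starting point. *)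

theory Defs
  imports "HOL-Combinatorics.Permutations"
begin

text \<open>
  A permutation of size \<open>n\<close> is a function \<open>p :: nat \<Rightarrow> nat\<close> with
  \<open>p permutes {1..n}\<close>; its word is \<open>p 1, \<dots>, p n\<close>.
\<close>

definition excedances :: "nat \<Rightarrow> (nat \<Rightarrow> nat) \<Rightarrow> nat set"
  where "excedances n p = {i \<in> {1..n - 1}. p i > i}"

definition dexc :: "nat \<Rightarrow> (nat \<Rightarrow> nat) \<Rightarrow> nat"
  where "dexc n p = (\<Sum>i\<in>excedances n p. p i - i)"

definition inv_count :: "nat \<Rightarrow> (nat \<Rightarrow> nat) \<Rightarrow> nat"
  where "inv_count n p =
    card {(i, j). i \<in> {1..n} \<and> j \<in> {1..n} \<and> i < j \<and> p i > p j}"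

definition bi_increasing :: "nat \<Rightarrow> (nat \<Rightarrow> nat) \<Rightarrow> bool"
  where "bi_increasing n p \<longleftrightarrow> inv_count n p = dexc n p"

definition descents :: "nat \<Rightarrow> (nat \<Rightarrow> nat) \<Rightarrow> nat set"
  where "descents n p = {i \<in> {1..n - 1}. p i > p (i + 1)}"

definition des :: "nat \<Rightarrow> (nat \<Rightarrow> nat) \<Rightarrow> nat"
  where "des n p = card (descents n p)"

definition ddes :: "nat \<Rightarrow> (nat \<Rightarrow> nat) \<Rightarrow> nat"
  where "ddes n p = (\<Sum>i\<in>descents n p. p i - p (i + 1))"

datatype step = Up | Down | Solid | Broken

fun rise :: "step \<Rightarrow> int" where
  "rise Up = 1"
| "rise Down = - 1"
| "rise Solid = 0"
| "rise Broken = 0"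

text \<open>
  A lattice path from the origin is encoded by its list of steps.
  \<open>height w i\<close> is the ordinate of the lattice point with abscissa \<open>i\<close>, that is, the
  starting point of the step \<open>w ! i\<close> when \<open>i < length w\<close>.
\<close>

definition height :: "step list \<Rightarrow> nat \<Rightarrow> int"
  where "height w i = (\<Sum>s\<leftarrow>take i w. rise s)"

definition two_Motzkin_path :: "nat \<Rightarrow> step list \<Rightarrow> bool"
  where "two_Motzkin_path n w \<longleftrightarrow>
    length w = n \<and> (\<forall>i\<le>n. height w i \<ge> 0) \<and> height w n = 0"

definition no_broken_step_at_height_0 :: "step list \<Rightarrow> bool"
  where "no_broken_step_at_height_0 w \<longleftrightarrow>
    \<not> (\<exists>i<length w. w ! i = Broken \<and> height w i = 0)"

definition height_sum :: "step list \<Rightarrow> int"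
  where "height_sum w = (\<Sum>i<length w. height w i)"

end

theory Submission
  imports Defs
begin

text \<open>
  Comparing the inversions on the two sides of each position shows that a permutation is
  bi-increasing iff it avoids 321, so its word is a shuffle of two increasing sequences: the
  left-to-right maxima and the rest. A descent is exactly a maximum immediately followed by a
  non-maximum. The value \<open>v\<close> contributes the \<open>v\<close>-th step of the path: a descent bottom gives an
  up-step, a descent top a down-step, any other left-to-right maximum a solid step and any other
  non-maximum a broken one. The height of the \<open>v\<close>-th step is then the number of descents
  \<open>\<pi>\<^sub>i > \<pi>\<^sub>i\<^sub>+\<^sub>1\<close> with \<open>\<pi>\<^sub>i\<^sub>+\<^sub>1 < v \<le> \<pi>\<^sub>i\<close>, so the heights sum to \<open>ddes\<close>.

  Conversely, the path determines the word. Descents separate the word alternately into blocks of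
  maxima and blocks of non-maxima, and the block of a value can be read off the path: a maximum is
  preceded by as many descents as there are earlier down-steps, a non-maximum by as many as there
  are up-steps up to and including its own. The word is therefore obtained by sorting the values
  by (block, value).
\<close>

section \<open>Bi-increasing permutations as 321-avoiders\<close>

definition avoids_321 :: "nat \<Rightarrow> (nat \<Rightarrow> nat) \<Rightarrow> bool"
  where "avoids_321 n p \<longleftrightarrow>
    (\<forall>i\<in>{1..n}. \<forall>j\<in>{1..n}. \<forall>k\<in>{1..n}. i < j \<and> j < k \<longrightarrow> \<not> (p i > p j \<and> p j > p k))"

text \<open>Counting the earlier positions gives \<open>i - 1\<close>, counting the smaller values
  gives \<open>p i - 1\<close>. Both counts contain the earlier smaller entries \<open>?S\<close>;
  eliminating \<open>card ?S\<close> leaves this identity.\<close>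

lemma inversion_balance:
  fixes p :: "nat \<Rightarrow> nat"
  assumes p: "p permutes {1..n}" and i: "i \<in> {1..n}"
  shows "card {j \<in> {1..n}. i < j \<and> p j < p i} + i = card {j \<in> {1..n}. j < i \<and> p i < p j} + p i"
proof -
  let ?L = "{j \<in> {1..n}. i < j \<and> p j < p i}"
  let ?G = "{j \<in> {1..n}. j < i \<and> p i < p j}"
  let ?S = "{j \<in> {1..n}. j < i \<and> p j < p i}"
  have inj: "inj p" using p by (rule permutes_inj)
  have pi: "p i \<in> {1..n}" using permutes_in_image[OF p] i by simp
  have "card (?S \<union> ?G) = card ?S + card ?G"
    by (rule card_Un_disjoint) auto
  moreover have "?S \<union> ?G = {1..<i}"
  proof (rule set_eqI)
    fix j
    have "p j = p i \<longleftrightarrow> j = i" using inj by (simp add: inj_eq)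
    then show "j \<in> ?S \<union> ?G \<longleftrightarrow> j \<in> {1..<i}" using i by auto
  qed
  ultimately have 1: "card ?S + card ?G = i - 1" by simp
  have "card (?S \<union> ?L) = card ?S + card ?L"
    by (rule card_Un_disjoint) auto
  moreover have "?S \<union> ?L = {j \<in> {1..n}. p j < p i}"
  proof (rule set_eqI)
    fix j show "j \<in> ?S \<union> ?L \<longleftrightarrow> j \<in> {j \<in> {1..n}. p j < p i}"
      by (cases j i rule: linorder_cases) auto
  qed
  moreover have "card {j \<in> {1..n}. p j < p i} = card {1..<p i}"
  proof (rule bij_betw_same_card[of p])
    have "p ` {j \<in> {1..n}. p j < p i} = {v \<in> p ` {1..n}. v < p i}" by auto
    also have "\<dots> = {1..<p i}" unfolding permutes_image[OF p] using pi by auto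
    finally show "bij_betw p {j \<in> {1..n}. p j < p i} {1..<p i}"
      using inj by (auto simp: bij_betw_def intro: inj_on_subset)
  qed
  ultimately have 2: "card ?S + card ?L = p i - 1" by simp
  show ?thesis using 1 2 i pi by auto
qed

text \<open>By the balance, \<open>p i - i\<close> is at most \<open>card (L i)\<close>, with
  equality iff \<open>L i\<close> or \<open>G i\<close> is empty. Hence the sums agree iff no
  \<open>i\<close> is the middle of a 321 pattern.\<close>

lemma bi_increasing_iff_avoids_321:
  assumes p: "p permutes {1..n}"
  shows "bi_increasing n p \<longleftrightarrow> avoids_321 n p"
proof -
  define L where "L i = {j \<in> {1..n}. i < j \<and> p j < p i}" for i
  define G where "G i = {j \<in> {1..n}. j < i \<and> p i < p j}" for i
  have fin: "finite (L i)" "finite (G i)" for i by (auto simp: L_def G_def)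
  have bal: "card (L i) + i = card (G i) + p i" if "i \<in> {1..n}" for i
    unfolding L_def G_def using inversion_balance[OF p that] .
  have "{(i, j). i \<in> {1..n} \<and> j \<in> {1..n} \<and> i < j \<and> p i > p j} = Sigma {1..n} L"
    by (auto simp: L_def)
  then have inv: "inv_count n p = (\<Sum>i\<in>{1..n}. card (L i))"
    unfolding inv_count_def by (simp add: fin)
  have "p i \<le> n" if "i \<in> {1..n}" for i using permutes_in_image[OF p, of i] that by simp
  \<comment> \<open>Truncated subtraction yields 0 off the excedances, so the sum may run over all
    positions.\<close>
  then have dx: "dexc n p = (\<Sum>i\<in>{1..n}. p i - i)"
    unfolding dexc_def excedances_def
    by (intro sum.mono_neutral_left) (auto simp: le_diff_conv not_less, force)
  have le: "p i - i \<le> card (L i)" if "i \<in> {1..n}" for i using bal[OF that] by linarith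
  have "bi_increasing n p \<longleftrightarrow> (\<forall>i\<in>{1..n}. p i - i = card (L i))"
    unfolding bi_increasing_def inv dx
    using sum_mono_inv[of "\<lambda>i. p i - i" "{1..n}" "\<lambda>i. card (L i)"] le by fastforce
  also have "\<dots> \<longleftrightarrow> (\<forall>i\<in>{1..n}. L i = {} \<or> G i = {})"
  proof (rule ball_cong[OF refl])
    fix i assume i: "i \<in> {1..n}"
    have "p i - i = card (L i) \<longleftrightarrow> card (L i) = 0 \<or> card (G i) = 0"
      using bal[OF i] by linarith
    then show "p i - i = card (L i) \<longleftrightarrow> L i = {} \<or> G i = {}" using fin by simp
  qed
  also have "\<dots> \<longleftrightarrow> avoids_321 n p"
    unfolding avoids_321_def L_def G_def by blast
  finally show ?thesis .
qed

section \<open>Sorting by an injective key\<close>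

lemma sorting_permutation_exists:
  fixes key :: "nat \<Rightarrow> nat"
  assumes inj: "inj_on key {1..n}"
  shows "\<exists>p. p permutes {1..n} \<and> strict_mono_on {1..n} (key \<circ> p)"
proof -
  define xs where "xs = sorted_list_of_set (key ` {1..n})"
  have len: "length xs = n" and st: "set xs = key ` {1..n}" and
    srt: "sorted_wrt (<) xs" and dst: "distinct xs"
    using inj by (auto simp: xs_def card_image)
  \<comment> \<open>List indices start at 0, hence the shift; outside the range
    \<open>permutes\<close> requires the identity.\<close>
  define p where "p i = (if i \<in> {1..n} then inv_into {1..n} key (xs ! (i - 1)) else i)" for i
  have mem: "xs ! (i - 1) \<in> key ` {1..n}" if "i \<in> {1..n}" for i
  proof -
    have "i - 1 < length xs" using that len by auto
    then show ?thesis using st nth_mem by blast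
  qed
  have key: "key (p i) = xs ! (i - 1)" if "i \<in> {1..n}" for i
    using mem[OF that] that by (simp add: p_def f_inv_into_f)
  have into: "p i \<in> {1..n}" if "i \<in> {1..n}" for i
    using inv_into_into[OF mem[OF that]] that by (simp add: p_def)
  have mono: "strict_mono_on {1..n} (key \<circ> p)"
  proof (rule strict_mono_onI)
    fix r s assume "r \<in> {1..n}" "s \<in> {1..n}" "r < s"
    moreover from this have "xs ! (r - 1) < xs ! (s - 1)"
      using sorted_wrt_nth_less[OF srt, of "r - 1" "s - 1"] len by auto
    ultimately show "(key \<circ> p) r < (key \<circ> p) s" using key by simp
  qed
  then have "inj_on (key \<circ> p) {1..n}" by (rule strict_mono_on_imp_inj_on)
  then have "inj_on p {1..n}" by (rule inj_on_imageI2)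
  moreover have "p ` {1..n} \<subseteq> {1..n}" using into by auto
  ultimately have "bij_betw p {1..n} {1..n}"
    by (simp add: bij_betw_def endo_inj_surj)
  then have "p permutes {1..n}" by (rule bij_imp_permutes) (auto simp: p_def)
  with mono show ?thesis by blast
qed

text \<open>The position of a value is the rank of its key, which does not depend on the sorting
  permutation.\<close>

lemma sorting_permutation_unique:
  fixes key :: "nat \<Rightarrow> nat"
  assumes p: "p permutes {1..n}" "strict_mono_on {1..n} (key \<circ> p)"
    and q: "q permutes {1..n}" "strict_mono_on {1..n} (key \<circ> q)"
  shows "p = q"
proof -
  have rank: "card {x \<in> {1..n}. key x \<le> key (r i)} = i"
    if r: "r permutes {1..n}" "strict_mono_on {1..n} (key \<circ> r)" and i: "i \<in> {1..n}" for r i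
  proof -
    have "{x \<in> {1..n}. key x \<le> key (r i)} = {x \<in> r ` {1..n}. key x \<le> key (r i)}"
      by (simp only: permutes_image[OF r(1)])
    also have "\<dots> = r ` {j \<in> {1..n}. (key \<circ> r) j \<le> (key \<circ> r) i}" by auto
    also have "{j \<in> {1..n}. (key \<circ> r) j \<le> (key \<circ> r) i} = {1..i}"
      using strict_mono_on_less_eq[OF r(2) _ i] i by auto
    finally show ?thesis
      using permutes_inj[OF r(1)] by (simp add: card_image inj_on_subset)
  qed
  show ?thesis
  proof
    fix i
    show "p i = q i"
    proof (cases "i \<in> {1..n}")
      case True
      have "p i \<in> {1..n}" using permutes_in_image[OF p(1)] True by simp
      then have "p i \<in> q ` {1..n}" by (simp only: permutes_image[OF q(1)])
      then obtain j where j: "j \<in> {1..n}" "p i = q j" by blast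
      then show ?thesis using rank[OF p True] rank[OF q j(1)] by simp
    next
      case False
      then show ?thesis using p(1) q(1) by (simp add: permutes_not_in)
    qed
  qed
qed

section \<open>Counting steps in prefixes of a path\<close>

definition occ :: "step \<Rightarrow> step list \<Rightarrow> nat \<Rightarrow> nat"
  where "occ s w i = count_list (take i w) s"

lemma occ_0 [simp]: "occ s w 0 = 0"
  by (simp add: occ_def)

lemma occ_Suc:
  "i < length w \<Longrightarrow> occ s w (Suc i) = occ s w i + (if w ! i = s then 1 else 0)"
  by (simp add: occ_def take_Suc_conv_app_nth)

lemma occ_mono: "i \<le> j \<Longrightarrow> occ s w i \<le> occ s w j"
proof -
  assume "i \<le> j"
  then have "take j w = take i w @ take (j - i) (drop i w)"
    by (metis le_add_diff_inverse take_add)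
  then show ?thesis by (simp add: occ_def)
qed

text \<open>The count grows by at most one per step, so it equals \<open>m\<close> just before the
  occurrence number \<open>m + 1\<close> of \<open>s\<close>.\<close>

lemma occ_obtain:
  assumes "m < occ s w k" "k \<le> length w"
  shows "\<exists>i<k. w ! i = s \<and> occ s w i = m"
  using assms
proof (induction k)
  case (Suc k)
  then show ?case
    by (cases "m < occ s w k") (auto simp: occ_Suc less_Suc_eq split: if_splits)
qed simp

lemma occ_card:
  "i \<le> length w \<Longrightarrow> occ s w i = card {x. x < i \<and> w ! x = s}"
proof (induction i)
  case (Suc i)
  have "{x. x < Suc i \<and> w ! x = s} = (if w ! i = s then insert i else id) {x. x < i \<and> w ! x = s}"
    by (auto simp: less_Suc_eq)
  then show ?case using Suc by (simp add: occ_Suc)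
qed simp

lemma height_occ: "height w i = int (occ Up w i) - int (occ Down w i)"
proof -
  have "(\<Sum>s\<leftarrow>xs. rise s) = int (count_list xs Up) - int (count_list xs Down)" for xs
  proof (induction xs)
    case (Cons a xs) then show ?case by (cases a) auto
  qed simp
  then show ?thesis by (simp add: height_def occ_def)
qed

section \<open>Blocks and the sorting key\<close>

text \<open>
  The blocks of maxima are numbered \<open>1, 3, 5, \<dots>\<close> and those of non-maxima \<open>2, 4, \<dots>\<close>.
  The argument \<open>x\<close> is an index into \<open>w\<close>, so it stands for the value \<open>x + 1\<close>.
\<close>

definition block :: "step list \<Rightarrow> nat \<Rightarrow> nat"
  where "block w x =
    (if w ! x \<in> {Down, Solid} then 2 * occ Down w x + 1 else 2 * occ Up w (Suc x))"

text \<open>The lexicographic pair (block, value) packed into one number; a value is at most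
  \<open>length w\<close>, so it never carries into the block.\<close>

definition key :: "step list \<Rightarrow> nat \<Rightarrow> nat"
  where "key w v = block w (v - 1) * Suc (length w) + v"

lemma key_less_iff:
  assumes "u \<le> length w" "v \<le> length w"
  shows "key w u < key w v \<longleftrightarrow>
    block w (u - 1) < block w (v - 1) \<or> block w (u - 1) = block w (v - 1) \<and> u < v"
proof -
  have *: "a * Suc N + u < b * Suc N + v" if "a < b" "u \<le> N" for a b u v N :: nat
  proof -
    have "a * Suc N + u < Suc a * Suc N" using that by simp
    also have "\<dots> \<le> b * Suc N" using that by (intro mult_le_mono1) simp
    finally show ?thesis by simp
  qed
  show ?thesis unfolding key_def
    using *[of "block w (u - 1)" "block w (v - 1)" u "length w" v]
      *[of "block w (v - 1)" "block w (u - 1)" v "length w" u] assms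
    by (metis add_less_cancel_left linorder_neqE_nat order_less_asym)
qed

lemma inj_on_key: "inj_on (key w) {1..length w}"
  by (rule inj_onI) (metis atLeastAtMost_iff key_less_iff linorder_neqE_nat less_irrefl)

section \<open>The path of a permutation\<close>

definition lr_max :: "(nat \<Rightarrow> nat) \<Rightarrow> nat \<Rightarrow> bool"
  where "lr_max p i \<longleftrightarrow> (\<forall>j\<in>{1..<i}. p j < p i)"

text \<open>Descent tops and bottoms are recognised from the classes of two neighbouring positions.
  Position 1 is always a maximum, so \<open>i - 1\<close> is a genuine position when it is
  consulted.\<close>

definition letter :: "nat \<Rightarrow> (nat \<Rightarrow> nat) \<Rightarrow> nat \<Rightarrow> step"
  where "letter n p i =
    (if lr_max p i then (if i < n \<and> \<not> lr_max p (Suc i) then Down else Solid)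
     else (if lr_max p (i - 1) then Up else Broken))"

text \<open>Steps are ordered by value: index \<open>x\<close> belongs to the value
  \<open>Suc x\<close>, and \<open>inv p\<close> finds its position.\<close>

definition path_of :: "nat \<Rightarrow> (nat \<Rightarrow> nat) \<Rightarrow> step list"
  where "path_of n p = map (\<lambda>x. letter n p (inv p (Suc x))) [0..<n]"

lemma length_path_of [simp]: "length (path_of n p) = n"
  by (simp add: path_of_def)

lemma path_of_nth:
  assumes "p permutes {1..n}" "i \<in> {1..n}"
  shows "path_of n p ! (p i - 1) = letter n p i"
proof -
  have "p i \<in> {1..n}" using permutes_in_image[OF assms(1)] assms(2) by simp
  moreover have "inv p (p i) = i" using assms(1) permutes_inj inv_f_f by metis
  ultimately show ?thesis by (cases "p i") (auto simp: path_of_def)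
qed

section \<open>From 321-avoiding permutations to paths\<close>

locale avoider =
  fixes n :: nat and p :: "nat \<Rightarrow> nat"
  assumes perm: "p permutes {1..n}" and avoids: "avoids_321 n p"
begin

lemma p_inj: "p i = p j \<longleftrightarrow> i = j"
  using permutes_inj[OF perm] by (auto dest: injD)

lemma p_in: "p i \<in> {1..n} \<longleftrightarrow> i \<in> {1..n}"
  using permutes_in_image[OF perm] .

lemma lr_maxD: "lr_max p i \<Longrightarrow> 1 \<le> j \<Longrightarrow> j < i \<Longrightarrow> p j < p i"
  by (simp add: lr_max_def)

text \<open>Some earlier value exceeds \<open>p i\<close>; a smaller value at \<open>k\<close> would
  complete a 321 pattern.\<close>

lemma not_lr_maxD:
  assumes "\<not> lr_max p i" "i < k" "k \<le> n"
  shows "p i < p k"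
proof -
  obtain j where j: "1 \<le> j" "j < i" "p i < p j"
    using assms(1) p_inj by (auto simp: lr_max_def not_less order_less_le)
  then have "\<not> p k < p i" using avoids assms(2,3) unfolding avoids_321_def by force
  then show ?thesis using p_inj assms(2) by (metis linorder_neqE_nat less_irrefl)
qed

text \<open>A non-maximum lies below its successor and a maximum above its predecessor, so a descent
  leads from a maximum to a non-maximum. Conversely, whatever exceeds \<open>p (Suc i)\<close>
  earlier is at most the maximum \<open>p i\<close>.\<close>

lemma descents_iff: "i \<in> descents n p \<longleftrightarrow> 1 \<le> i \<and> i < n \<and> lr_max p i \<and> \<not> lr_max p (Suc i)"
proof
  assume "i \<in> descents n p"
  then have i: "1 \<le> i" "i < n" "p (Suc i) < p i" by (auto simp: descents_def)
  then show "1 \<le> i \<and> i < n \<and> lr_max p i \<and> \<not> lr_max p (Suc i)"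
    using not_lr_maxD[of i "Suc i"] lr_maxD[of "Suc i" i] by force
next
  assume i: "1 \<le> i \<and> i < n \<and> lr_max p i \<and> \<not> lr_max p (Suc i)"
  then obtain j where j: "1 \<le> j" "j \<le> i" "p (Suc i) < p j"
    using p_inj by (auto simp: lr_max_def not_less order_less_le)
  then have "p j \<le> p i" using lr_maxD[of i j] i by (cases "j = i") auto
  with j i show "i \<in> descents n p" by (auto simp: descents_def)
qed

lemma letter_Down_iff: "i \<in> {1..n} \<Longrightarrow> letter n p i = Down \<longleftrightarrow> i \<in> descents n p"
  by (auto simp: letter_def descents_iff)

lemma not_lr_max_ge_2: "\<not> lr_max p i \<Longrightarrow> 2 \<le> i"
  by (cases "i \<le> 1") (auto simp: lr_max_def)

lemma letter_Up_iff: "i \<in> {1..n} \<Longrightarrow> letter n p i = Up \<longleftrightarrow> i \<in> Suc ` descents n p"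
  using not_lr_max_ge_2[of i] by (cases i) (auto simp: letter_def descents_iff image_iff)

lemma occ_path_of:
  assumes "m \<le> n"
  shows "occ s (path_of n p) m = card {i \<in> {1..n}. letter n p i = s \<and> p i \<le> m}"
proof -
  have "card {i \<in> {1..n}. letter n p i = s \<and> p i \<le> m} = card {x. x < m \<and> path_of n p ! x = s}"
  proof (rule bij_betw_same_card[of "\<lambda>i. p i - 1"], unfold bij_betw_def, intro conjI)
    show "inj_on (\<lambda>i. p i - 1) {i \<in> {1..n}. letter n p i = s \<and> p i \<le> m}"
    proof (rule inj_onI)
      fix i j assume "i \<in> {i \<in> {1..n}. letter n p i = s \<and> p i \<le> m}"
        "j \<in> {i \<in> {1..n}. letter n p i = s \<and> p i \<le> m}" "p i - 1 = p j - 1"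
      then show "i = j" using p_in[of i] p_in[of j] p_inj[of i j] by auto
    qed
    show "(\<lambda>i. p i - 1) ` {i \<in> {1..n}. letter n p i = s \<and> p i \<le> m} =
      {x. x < m \<and> path_of n p ! x = s}" (is "?l = ?r")
    proof
      show "?l \<subseteq> ?r"
      proof
        fix x assume "x \<in> ?l"
        then obtain i where "i \<in> {1..n}" "letter n p i = s" "p i \<le> m" "x = p i - 1" by blast
        then show "x \<in> ?r" using p_in[of i] path_of_nth[OF perm, of i] by auto
      qed
      show "?r \<subseteq> ?l"
      proof
        fix x assume x: "x \<in> ?r"
        then have "Suc x \<in> p ` {1..n}" unfolding permutes_image[OF perm] using assms by auto
        then obtain i where i: "i \<in> {1..n}" "p i = Suc x" by force
        then have "letter n p i = s" using x path_of_nth[OF perm, of i] by simp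
        then show "x \<in> ?l" using x i by (intro image_eqI[of _ _ i]) auto
      qed
    qed
  qed
  then show ?thesis using occ_card assms by simp
qed

lemma descents_subset: "descents n p \<subseteq> {1..<n}"
  by (auto simp: descents_def)

lemma finite_descents: "finite (descents n p)"
  using descents_subset finite_subset by blast

lemma occ_Down:
  assumes "m \<le> n"
  shows "occ Down (path_of n p) m = card {i \<in> descents n p. p i \<le> m}"
proof -
  have "{i \<in> {1..n}. letter n p i = Down \<and> p i \<le> m} = {i \<in> descents n p. p i \<le> m}"
    using descents_subset letter_Down_iff by fastforce
  then show ?thesis using occ_path_of[OF assms] by simp
qed

lemma occ_Up:
  assumes "m \<le> n"
  shows "occ Up (path_of n p) m = card {i \<in> descents n p. p (Suc i) \<le> m}"
proof -
  have "{i \<in> {1..n}. letter n p i = Up \<and> p i \<le> m} = Suc ` {i \<in> descents n p. p (Suc i) \<le> m}"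
    using descents_subset letter_Up_iff by fastforce
  then show ?thesis using occ_path_of[OF assms] by (simp add: card_image)
qed

text \<open>A descent whose top is at most \<open>m\<close> also has its bottom there. It adds one
  up-step and one down-step, which cancel; only descents straddling \<open>m\<close> remain.\<close>

lemma height_path_of:
  assumes "m \<le> n"
  shows "height (path_of n p) m = int (card {i \<in> descents n p. p (Suc i) \<le> m \<and> m < p i})"
proof -
  have "{i \<in> descents n p. p (Suc i) \<le> m} =
      {i \<in> descents n p. p i \<le> m} \<union> {i \<in> descents n p. p (Suc i) \<le> m \<and> m < p i}"
    by (auto simp: descents_def)
  moreover have "card ({i \<in> descents n p. p i \<le> m} \<union> {i \<in> descents n p. p (Suc i) \<le> m \<and> m < p i})
     = card {i \<in> descents n p. p i \<le> m} + card {i \<in> descents n p. p (Suc i) \<le> m \<and> m < p i}"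
    using finite_descents by (intro card_Un_disjoint) auto
  ultimately show ?thesis by (simp add: height_occ occ_Up occ_Down assms)
qed

lemma two_Motzkin_path_path_of: "two_Motzkin_path n (path_of n p)"
proof -
  have "{i \<in> descents n p. p (Suc i) \<le> n \<and> n < p i} = {}"
  proof -
    have "p i \<le> n" if "i \<in> descents n p" for i
      using that descents_subset p_in[of i] by auto
    then show ?thesis using leD by blast
  qed
  then have "height (path_of n p) n = 0" by (simp only: height_path_of order_refl card.empty of_nat_0)
  then show ?thesis by (simp add: two_Motzkin_path_def height_path_of)
qed

lemma count_Up_path_of: "count_list (path_of n p) Up = des n p"
proof -
  have "{i \<in> descents n p. p (Suc i) \<le> n} = descents n p"
  proof -
    have "p (Suc i) \<le> n" if "i \<in> descents n p" for i
      using that descents_subset p_in[of "Suc i"] by auto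
    then show ?thesis by auto
  qed
  then show ?thesis using occ_Up[of n] by (simp add: occ_def des_def)
qed

lemma height_sum_path_of: "height_sum (path_of n p) = int (ddes n p)"
proof -
  have "height_sum (path_of n p) =
      int (\<Sum>m<n. card {i \<in> descents n p. p (Suc i) \<le> m \<and> m < p i})"
    by (simp add: height_sum_def height_path_of)
  also have "(\<Sum>m<n. card {i \<in> descents n p. p (Suc i) \<le> m \<and> m < p i}) =
      (\<Sum>m<n. \<Sum>i\<in>descents n p. if p (Suc i) \<le> m \<and> m < p i then 1 else 0)"
    using finite_descents by (simp add: sum.If_cases Int_def)
  \<comment> \<open>Double counting: each descent straddles as many abscissas as its drop.\<close>
  also have "\<dots> = (\<Sum>i\<in>descents n p. \<Sum>m<n. if p (Suc i) \<le> m \<and> m < p i then 1 else 0)"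
    by (rule sum.swap)
  also have "\<dots> = (\<Sum>i\<in>descents n p. p i - p (Suc i))"
  proof (rule sum.cong[OF refl])
    fix i assume "i \<in> descents n p"
    then have "p i \<le> n" using descents_subset p_in[of i] by auto
    then have "{..<n} \<inter> {m. p (Suc i) \<le> m \<and> m < p i} = {p (Suc i)..<p i}" by auto
    then show "(\<Sum>m<n. if p (Suc i) \<le> m \<and> m < p i then 1 else 0) = p i - p (Suc i)"
      by (simp add: sum.If_cases)
  qed
  finally show ?thesis by (simp add: ddes_def)
qed

text \<open>The last maximum \<open>r\<close> before a broken position \<open>i\<close> is not at
  \<open>i - 1\<close>, so it is a descent top whose bottom lies strictly before \<open>i\<close>.
  That bottom is below \<open>p i\<close>, while \<open>p r\<close> is above it as the largest
  earlier value; this descent makes the height positive.\<close>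

lemma no_broken_path_of: "no_broken_step_at_height_0 (path_of n p)"
proof -
  have "height (path_of n p) x \<noteq> 0" if x: "x < n" and br: "path_of n p ! x = Broken" for x
  proof -
    have "Suc x \<in> p ` {1..n}" unfolding permutes_image[OF perm] using x by auto
    then obtain i where i: "i \<in> {1..n}" "p i = Suc x" by force
    then have "letter n p i = Broken" using path_of_nth[OF perm i(1)] br by simp
    then have nr: "\<not> lr_max p i" "\<not> lr_max p (i - 1)"
      by (auto simp: letter_def split: if_splits)
    define r where "r = Max {j \<in> {1..<i}. lr_max p j}"
    have fin: "finite {j \<in> {1..<i}. lr_max p j}" by simp
    have "1 \<in> {j \<in> {1..<i}. lr_max p j}"
      using not_lr_max_ge_2[OF nr(1)] by (auto simp: lr_max_def)
    then have r: "r \<in> {j \<in> {1..<i}. lr_max p j}" unfolding r_def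
      using Max_in[OF fin] by blast
    have r_max: "j \<le> r" if "j \<in> {1..<i}" "lr_max p j" for j
      unfolding r_def using that by (intro Max_ge[OF fin]) auto
    have ri: "Suc r < i" using r nr(2) by (cases "Suc r = i") auto
    have nr_r: "\<not> lr_max p (Suc r)" using r_max[of "Suc r"] ri by auto
    then have "r \<in> descents n p" using r i ri by (auto simp: descents_iff)
    moreover have "p (Suc r) < p i" using not_lr_maxD[OF nr_r ri] i by simp
    moreover have "p i < p r"
    proof -
      obtain j where j: "1 \<le> j" "j < i" "p i < p j"
        using nr(1) p_inj by (auto simp: lr_max_def not_less order_less_le)
      have "lr_max p j" using not_lr_maxD[of j i] j i by force
      then have "j \<le> r" using r_max j by simp
      then have "p j \<le> p r" using lr_maxD[of r j] r j by (cases "j = r") auto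
      then show ?thesis using j by simp
    qed
    ultimately have "r \<in> {j \<in> descents n p. p (Suc j) \<le> x \<and> x < p j}" using i by auto
    then show ?thesis using x finite_descents height_path_of[of x] by (auto simp: card_eq_0_iff)
  qed
  then show ?thesis by (auto simp: no_broken_step_at_height_0_def)
qed

text \<open>Maxima increase from left to right, and so do non-maxima. Comparing \<open>p i\<close>
  with descent tops, respectively bottoms, by value is therefore comparing positions.\<close>

lemma block_path_of:
  assumes i: "i \<in> {1..n}"
  shows "block (path_of n p) (p i - 1) =
    2 * card {j \<in> descents n p. j < i} + (if lr_max p i then 1 else 0)"
proof (cases "lr_max p i")
  case True
  have pi: "p i \<in> {1..n}" using p_in i by simp
  have "p j \<le> p i - 1 \<longleftrightarrow> j < i" if j: "j \<in> descents n p" for j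
  proof -
    have "lr_max p j" "1 \<le> j" using j by (auto simp: descents_iff)
    then have "p j < p i \<longleftrightarrow> j < i"
      using lr_maxD[of j i] lr_maxD[OF True, of j] i
      by (metis atLeastAtMost_iff linorder_neqE_nat order_less_asym)
    then show ?thesis using pi by auto
  qed
  then have "{j \<in> descents n p. p j \<le> p i - 1} = {j \<in> descents n p. j < i}" by blast
  moreover have "p i - 1 \<le> n" using pi by auto
  moreover have "letter n p i \<in> {Down, Solid}" using True by (simp add: letter_def)
  ultimately show ?thesis
    using True by (simp add: block_def path_of_nth[OF perm i] occ_Down del: One_nat_def)
next
  case False
  have pi: "p i \<in> {1..n}" using p_in i by simp
  \<comment> \<open>The case \<open>Suc j = i\<close> counts: a bottom belongs to the block that it
    opens, hence the \<open>Suc x\<close> in \<open>block\<close>.\<close>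
  have "p (Suc j) \<le> p i \<longleftrightarrow> j < i" if j: "j \<in> descents n p" for j
  proof -
    have "\<not> lr_max p (Suc j)" "j < n" using j by (auto simp: descents_iff)
    then show ?thesis
      using not_lr_maxD[of "Suc j" i] not_lr_maxD[OF False, of "Suc j"] i p_inj[of "Suc j" i]
      by (cases "Suc j" i rule: linorder_cases) auto
  qed
  then have "{j \<in> descents n p. p (Suc j) \<le> p i} = {j \<in> descents n p. j < i}" by blast
  moreover have "Suc (p i - 1) = p i" "p i \<le> n" using pi by auto
  moreover have "letter n p i \<notin> {Down, Solid}" using False by (simp add: letter_def)
  ultimately show ?thesis
    using False by (simp add: block_def path_of_nth[OF perm i] occ_Up del: One_nat_def)
qed

text \<open>It suffices to compare neighbours. Across a descent the block number rises by one;
  elsewhere it does not fall and the value grows.\<close>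

lemma strict_mono_on_key_path_of: "strict_mono_on {1..n} (key (path_of n p) \<circ> p)"
proof -
  have step: "key (path_of n p) (p i) < key (path_of n p) (p (Suc i))" if i: "1 \<le> i" "i < n" for i
  proof -
    have ins: "p i \<in> {1..n}" "p (Suc i) \<in> {1..n}" using p_in i by auto
    let ?c = "\<lambda>i. card {j \<in> descents n p. j < i}"
    have c: "?c (Suc i) = ?c i + (if i \<in> descents n p then 1 else 0)"
    proof -
      have "{j \<in> descents n p. j < Suc i} =
        (if i \<in> descents n p then insert i else id) {j \<in> descents n p. j < i}"
        by (auto simp: less_Suc_eq)
      then show ?thesis using finite_descents by simp
    qed
    have asc: "p i < p (Suc i)" if "i \<notin> descents n p"
      using that i p_inj[of i "Suc i"] by (auto simp: descents_def)
    have "i \<in> descents n p \<longleftrightarrow> lr_max p i \<and> \<not> lr_max p (Suc i)" using i by (simp add: descents_iff)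
    moreover have "block (path_of n p) (p i - 1) = 2 * ?c i + (if lr_max p i then 1 else 0)"
      "block (path_of n p) (p (Suc i) - 1) =
        2 * ?c (Suc i) + (if lr_max p (Suc i) then 1 else 0)"
      using block_path_of[of i] block_path_of[of "Suc i"] i by simp_all
    ultimately show ?thesis
      using c asc ins by (auto simp: key_less_iff simp del: One_nat_def)
  qed
  have "1 \<le> r \<Longrightarrow> r < s \<Longrightarrow> s \<le> n \<Longrightarrow>
    key (path_of n p) (p r) < key (path_of n p) (p s)" for r s
  proof (induction s)
    case (Suc s)
    then show ?case using step[of s] by (cases "r = s") auto
  qed simp
  then show ?thesis by (intro strict_mono_onI) auto
qed

end

section \<open>From paths back to permutations\<close>

locale motzkin_sorted =
  fixes n :: nat and w :: "step list" and p :: "nat \<Rightarrow> nat"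
  assumes path: "two_Motzkin_path n w" and no_broken: "no_broken_step_at_height_0 w"
    and perm: "p permutes {1..n}" and sorted: "strict_mono_on {1..n} (key w \<circ> p)"
begin

text \<open>The class that \<open>w\<close> intends for a value; \<open>lr_max_iff_upper\<close>
  later shows that the sorted word realises it.\<close>

abbreviation upper :: "nat \<Rightarrow> bool"
  where "upper x \<equiv> w ! x \<in> {Down, Solid}"

lemma len: "length w = n"
  using path by (simp add: two_Motzkin_path_def)

lemma occ_Down_le_Up: "i \<le> n \<Longrightarrow> occ Down w i \<le> occ Up w i"
  using path by (force simp: two_Motzkin_path_def height_occ)

lemma occ_total: "occ Down w n = occ Up w n"
  using path by (force simp: two_Motzkin_path_def height_occ)

lemma occ_Down_less_Up: "x < n \<Longrightarrow> w ! x = Broken \<Longrightarrow> occ Down w x < occ Up w x"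
  using no_broken occ_Down_le_Up[of x]
  by (force simp: no_broken_step_at_height_0_def height_occ len)

lemma p_in: "p i \<in> {1..n} \<longleftrightarrow> i \<in> {1..n}"
  using permutes_in_image[OF perm] .

lemma p_pred: "i \<in> {1..n} \<Longrightarrow> p i - 1 < n \<and> Suc (p i - 1) = p i"
  using p_in[of i] by auto

lemma position_obtain:
  assumes "x < n"
  obtains i where "i \<in> {1..n}" "p i = Suc x"
proof -
  have "Suc x \<in> p ` {1..n}" unfolding permutes_image[OF perm] using assms by auto
  then show ?thesis using that by force
qed

lemma less_iff:
  assumes "i \<in> {1..n}" "j \<in> {1..n}"
  shows "i < j \<longleftrightarrow> block w (p i - 1) < block w (p j - 1) \<or>
    block w (p i - 1) = block w (p j - 1) \<and> p i < p j"
proof -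
  have "i < j \<longleftrightarrow> key w (p i) < key w (p j)"
    using strict_mono_on_less[OF sorted assms] by simp
  then show ?thesis using assms p_in[of i] p_in[of j] by (simp add: key_less_iff len)
qed

lemma block_mono:
  assumes "upper x \<longleftrightarrow> upper y" "x \<le> y"
  shows "block w x \<le> block w y"
  using assms occ_mono[of x y Down w] occ_mono[of "Suc x" "Suc y" Up w]
  by (auto simp: block_def)

text \<open>Within one class the block grows weakly with the value, so sorting by (block, value) is
  sorting by value.\<close>

lemma less_same_class:
  assumes "i \<in> {1..n}" "j \<in> {1..n}" "i < j" "upper (p i - 1) \<longleftrightarrow> upper (p j - 1)"
  shows "p i < p j"
proof (rule ccontr)
  assume "\<not> p i < p j"
  then have "block w (p j - 1) \<le> block w (p i - 1)"
    using assms(4) by (intro block_mono) auto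
  then show False using less_iff[OF assms(1,2)] assms(3) \<open>\<not> p i < p j\<close> by auto
qed

text \<open>An earlier, larger value of the lower class would be a broken step with no more up-steps
  than down-steps before it, hence at height 0.\<close>

lemma less_upper:
  assumes ij: "i \<in> {1..n}" "j \<in> {1..n}" "i < j" and up: "upper (p j - 1)"
  shows "p i < p j"
proof (cases "upper (p i - 1)")
  case True
  then show ?thesis using less_same_class[OF ij] up by simp
next
  case False
  let ?x = "p i - 1" and ?y = "p j - 1"
  show ?thesis
  proof (rule ccontr)
    assume "\<not> p i < p j"
    then have yx: "?y \<le> ?x" by simp
    with up False have "?y < ?x" by (metis order_less_le)
    have x: "?x < n" using p_pred ij by blast
    have "2 * occ Up w (Suc ?x) \<le> 2 * occ Down w ?y + 1"
      using less_iff[OF ij(1,2)] ij(3) False up by (auto simp: block_def)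
    \<comment> \<open>Parity: an even number bounded by an odd one loses the 1.\<close>
    then have 1: "occ Up w (Suc ?x) \<le> occ Down w ?y" by linarith
    have 2: "occ Down w ?y \<le> occ Down w ?x" using yx by (rule occ_mono)
    have 3: "occ Down w ?x \<le> occ Up w ?x" using x by (intro occ_Down_le_Up) simp
    have "w ! ?x = Broken"
      using 1 2 3 x False by (cases "w ! ?x") (auto simp: occ_Suc len)
    then have "occ Down w ?x < occ Up w ?x" using x occ_Down_less_Up by blast
    moreover have "occ Up w ?x \<le> occ Up w (Suc ?x)" by (rule occ_mono) simp
    ultimately show False using 1 2 by linarith
  qed
qed

text \<open>The witness is the descent top that ends the preceding block of maxima.\<close>

lemma lower_preceded:
  assumes i: "i \<in> {1..n}" and low: "\<not> upper (p i - 1)"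
  obtains j where "j \<in> {1..n}" "j < i" "p i < p j" "w ! (p j - 1) = Down"
    "Suc (occ Down w (p j - 1)) = occ Up w (p i)"
proof -
  let ?x = "p i - 1"
  have x: "?x < n" "Suc ?x = p i" using p_pred[OF i] by auto
  have nonneg: "occ Down w ?x \<le> occ Up w ?x" using x by (intro occ_Down_le_Up) simp
  have brk: "w ! ?x = Broken \<Longrightarrow> occ Down w ?x < occ Up w ?x" using occ_Down_less_Up x by blast
  have S: "occ Up w (p i) = occ Up w ?x + (if w ! ?x = Up then 1 else 0)"
    using occ_Suc[of ?x w Up] x len by simp
  have pos: "occ Down w ?x < occ Up w (p i)"
    using nonneg brk S low by (cases "w ! ?x") auto
  \<comment> \<open>The path returns to height 0, so the down-step of rank
    \<open>occ Up w (p i)\<close> exists; its block is the one just before that of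
    \<open>?x\<close>.\<close>
  have "occ Up w (p i) \<le> occ Down w n"
    unfolding occ_total using x by (intro occ_mono) simp
  then have "occ Up w (p i) - 1 < occ Down w n" using pos by linarith
  then obtain t where t: "t < n" "w ! t = Down" "occ Down w t = occ Up w (p i) - 1"
    using occ_obtain[of "occ Up w (p i) - 1" Down w n] len by blast
  obtain j where j: "j \<in> {1..n}" "p j = Suc t" using position_obtain[OF t(1)] .
  \<comment> \<open>Otherwise this down-step would be counted in \<open>occ Down w ?x\<close>, which
    is too small by \<open>pos\<close>.\<close>
  have xt: "?x < t"
  proof (rule ccontr)
    assume "\<not> ?x < t"
    moreover have "t \<noteq> ?x" using low t by auto
    ultimately have "occ Down w (Suc t) \<le> occ Down w ?x" by (intro occ_mono) simp
    then show False using t pos len occ_Suc[of t w Down] by simp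
  qed
  have "block w t < block w ?x" using t low pos x by (auto simp: block_def)
  then have "j < i" using less_iff[OF j(1) i] j(2) by simp
  then show ?thesis using that[of j] j t xt pos x by simp
qed

lemma lr_max_iff_upper:
  assumes i: "i \<in> {1..n}"
  shows "lr_max p i \<longleftrightarrow> upper (p i - 1)"
proof
  assume l: "lr_max p i"
  show "upper (p i - 1)"
  proof (rule ccontr)
    assume "\<not> upper (p i - 1)"
    then obtain j where j: "j \<in> {1..n}" "j < i" "p i < p j"
      using lower_preceded[OF i] by metis
    then have "p j < p i" using l by (simp add: lr_max_def)
    then show False using j by simp
  qed
next
  assume "upper (p i - 1)"
  then show "lr_max p i" using less_upper[of _ i] i by (auto simp: lr_max_def)
qed

text \<open>The last two entries of a 321 pattern follow larger ones, so both are lower; but lower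
  values increase.\<close>

lemma avoids: "avoids_321 n p"
  unfolding avoids_321_def
proof (intro ballI impI notI)
  fix i j k
  assume ijk: "i \<in> {1..n}" "j \<in> {1..n}" "k \<in> {1..n}" "i < j \<and> j < k" "p i > p j \<and> p j > p k"
  then have "\<not> upper (p j - 1)" "\<not> upper (p k - 1)"
    using less_upper[of i j] less_upper[of j k] by auto
  then show False using less_same_class[of j k] ijk by simp
qed

lemma upper_letter:
  assumes i: "i \<in> {1..n}" and up: "upper (p i - 1)"
  shows "w ! (p i - 1) = Down \<longleftrightarrow> i < n \<and> \<not> upper (p (Suc i) - 1)"
proof
  let ?x = "p i - 1"
  have x: "?x < n" "Suc ?x = p i" using p_pred[OF i] by auto
  assume D: "w ! ?x = Down"
  have "Suc (occ Down w ?x) = occ Down w (p i)"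
    using occ_Suc[of ?x w Down] D x len by simp
  also have "\<dots> \<le> occ Down w n" using x by (intro occ_mono) simp
  finally have "occ Down w ?x < occ Up w n" using occ_total by simp
  \<comment> \<open>The up-step of the same rank as the down-step \<open>?x\<close>: it opens the
    block following that of \<open>?x\<close>, so position \<open>i\<close> is not the last.\<close>
  then obtain b where b: "b < n" "w ! b = Up" "occ Up w b = occ Down w ?x"
    using occ_obtain[of "occ Down w ?x" Up w n] len by auto
  obtain j where j: "j \<in> {1..n}" "p j = Suc b" using position_obtain[OF b(1)] .
  have bb: "block w b = 2 * occ Down w ?x + 2" using b len by (simp add: block_def occ_Suc)
  have "block w ?x = 2 * occ Down w ?x + 1" using D by (simp add: block_def)
  then have ij: "i < j" using less_iff[OF i j(1)] bb j(2) by simp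
  then have i1: "i < n" "Suc i \<in> {1..n}" using j(1) by auto
  have "\<not> upper (p (Suc i) - 1)"
  proof
    let ?y = "p (Suc i) - 1"
    assume u: "upper ?y"
    then have "Suc i \<noteq> j" using b j by auto
    then have "block w ?y \<le> block w b" using less_iff[OF i1(2) j(1)] ij j(2) by auto
    then have 1: "occ Down w ?y \<le> occ Down w ?x" using u bb by (auto simp: block_def)
    have "p i < p (Suc i)" using less_upper[OF i i1(2)] u by simp
    then have "occ Down w (Suc ?x) \<le> occ Down w ?y" using x by (intro occ_mono) simp
    then show False using 1 D x len occ_Suc[of ?x w Down] by simp
  qed
  with i1 show "i < n \<and> \<not> upper (p (Suc i) - 1)" by blast
next
  let ?x = "p i - 1" and ?y = "p (Suc i) - 1"
  have x: "?x < n" "Suc ?x = p i" using p_pred[OF i] by auto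
  assume low: "i < n \<and> \<not> upper ?y"
  then have i1: "Suc i \<in> {1..n}" by simp
  have y: "?y < n" "Suc ?y = p (Suc i)" using p_pred[OF i1] by auto
  show "w ! ?x = Down"
  proof (rule ccontr)
    assume nD: "w ! ?x \<noteq> Down"
    have bx: "block w ?x = 2 * occ Down w ?x + 1" using up by (simp add: block_def)
    have By: "block w ?y = 2 * occ Up w (Suc ?y)" using low by (auto simp: block_def)
    have "block w ?x \<le> block w ?y" using less_iff[OF i i1] by auto
    then have 1: "occ Down w ?x < occ Up w (Suc ?y)" using bx By by linarith
    also have "\<dots> \<le> occ Down w n" unfolding occ_total using y by (intro occ_mono) simp
    \<comment> \<open>The down-step that closes the block of \<open>?x\<close>. It lies beyond
      \<open>?x\<close>, so its position would fall strictly between \<open>i\<close> and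
      \<open>Suc i\<close>.\<close>
    finally obtain t where t: "t < n" "w ! t = Down" "occ Down w t = occ Down w ?x"
      using occ_obtain[of "occ Down w ?x" Down w n] len by auto
    obtain j where j: "j \<in> {1..n}" "p j = Suc t" using position_obtain[OF t(1)] .
    have bt: "block w t = block w ?x" using t bx by (simp add: block_def)
    have "\<not> t < ?x"
    proof
      assume "t < ?x"
      then have "occ Down w (Suc t) \<le> occ Down w ?x" by (intro occ_mono) simp
      then show False using t len by (simp add: occ_Suc)
    qed
    moreover have "t \<noteq> ?x" using nD t by auto
    ultimately have "i < j" using less_iff[OF i j(1)] bt j(2) x by simp
    moreover have "block w t < block w ?y" using bt bx By 1 by simp
    then have "j < Suc i" using less_iff[OF j(1) i1] j(2) by simp
    ultimately show False by simp
  qed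
qed

lemma lower_letter:
  assumes i: "i \<in> {1..n}" and low: "\<not> upper (p i - 1)"
  shows "w ! (p i - 1) = Up \<longleftrightarrow> upper (p (i - 1) - 1)"
proof -
  let ?x = "p i - 1" and ?y = "p (i - 1) - 1"
  have x: "?x < n" "Suc ?x = p i" using p_pred[OF i] by auto
  obtain j where j: "j \<in> {1..n}" "j < i" "w ! (p j - 1) = Down"
    "Suc (occ Down w (p j - 1)) = occ Up w (p i)"
    using lower_preceded[OF i low] by metis
  \<comment> \<open>The descent top \<open>j\<close> shows that \<open>i\<close> is not the first
    position.\<close>
  then have i1: "i - 1 \<in> {1..n}" "i - 1 < i" using i by auto
  have y: "?y < n" "Suc ?y = p (i - 1)" using p_pred[OF i1(1)] by auto
  have bx: "block w ?x = 2 * occ Up w (p i)" using low x by (auto simp: block_def)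
  show ?thesis
  proof
    assume U: "w ! ?x = Up"
    show "upper ?y"
    proof (rule ccontr)
      assume l: "\<not> upper ?y"
      have By: "block w ?y = 2 * occ Up w (Suc ?y)" using l by (auto simp: block_def)
      have bj: "Suc (block w (p j - 1)) = 2 * occ Up w (p i)"
        using j(3) j(4)[symmetric] by (simp add: block_def)
      have "j \<noteq> i - 1" using l j(3) by auto
      then have "block w (p j - 1) \<le> block w ?y" using less_iff[OF j(1) i1(1)] j(2) by auto
      \<comment> \<open>By parity again: position \<open>i - 1\<close> comes after \<open>j\<close>
        and has an even block number, so it reaches the block of \<open>i\<close>. Its smaller
        value, however, does not yet count the up-step \<open>?x\<close>.\<close>
      then have 1: "occ Up w (p i) \<le> occ Up w (Suc ?y)" using By bj by linarith
      have "p (i - 1) < p i" using less_same_class[OF i1(1) i i1(2)] l low by simp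
      then have "occ Up w (Suc ?y) \<le> occ Up w ?x" using y by (intro occ_mono) simp
      then show False using 1 U occ_Suc[of ?x w Up] x len by simp
    qed
  next
    assume u: "upper ?y"
    show "w ! ?x = Up"
    proof (rule ccontr)
      assume nU: "w ! ?x \<noteq> Up"
      then have "occ Up w (p i) = occ Up w ?x" using occ_Suc[of ?x w Up] x len by simp
      \<comment> \<open>The up-step that opened the block of \<open>?x\<close>. Position
        \<open>i - 1\<close> would lie between it and \<open>i\<close>, inside one even block,
        whereas upper values have odd blocks.\<close>
      then obtain b where b: "b < ?x" "w ! b = Up" "Suc (occ Up w b) = occ Up w (p i)"
        using occ_obtain[of "occ Up w (p i) - 1" Up w ?x] j(4) len x by fastforce
      have bn: "b < n" using b x by simp
      have bb: "block w b = block w ?x" using b bn bx len by (simp add: block_def occ_Suc)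
      obtain l where l: "l \<in> {1..n}" "p l = Suc b" using position_obtain[OF bn] .
      have "l < i" using less_iff[OF l(1) i] l(2) bb b x by simp
      moreover have "l \<noteq> i - 1" using l(2) u b by auto
      ultimately have "l < i - 1" by simp
      then have "block w b \<le> block w ?y" using less_iff[OF l(1) i1(1)] l(2) by auto
      moreover have "block w ?y \<le> block w ?x" using less_iff[OF i1(1) i] i1(2) by auto
      ultimately have "block w ?y = 2 * occ Up w (p i)" using bb bx by simp
      moreover have "block w ?y = 2 * occ Down w ?y + 1" using u by (simp add: block_def)
      ultimately show False by presburger
    qed
  qed
qed

lemma path_of_eq: "path_of n p = w"
proof (rule nth_equalityI)
  show "length (path_of n p) = length w" by (simp add: len)
next
  fix x assume "x < length (path_of n p)"
  then have "x < n" by simp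
  then obtain i where i: "i \<in> {1..n}" "p i = Suc x" using position_obtain by blast
  have "letter n p i = w ! (p i - 1)"
  proof (cases "upper (p i - 1)")
    case True
    have "i < n \<Longrightarrow> lr_max p (Suc i) \<longleftrightarrow> upper (p (Suc i) - 1)"
      using lr_max_iff_upper[of "Suc i"] by simp
    then show ?thesis
      using True upper_letter[OF i(1) True] lr_max_iff_upper[OF i(1)] by (auto simp: letter_def)
  next
    case False
    \<comment> \<open>The witness only serves to place \<open>i - 1\<close> in the range of
      positions.\<close>
    then obtain j where "j \<in> {1..n}" "j < i" using lower_preceded[OF i(1)] by metis
    then have "lr_max p (i - 1) \<longleftrightarrow> upper (p (i - 1) - 1)"
      using i(1) by (intro lr_max_iff_upper) auto
    then show ?thesis
      using False lower_letter[OF i(1) False] lr_max_iff_upper[OF i(1)]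
      by (cases "w ! (p i - 1)") (auto simp: letter_def)
  qed
  then show "path_of n p ! x = w ! x" using path_of_nth[OF perm i(1)] i(2) by simp
qed

end

theorem theorem4p8:
  fixes n d k :: nat
  assumes "n \<ge> 1"
  shows "\<exists>f :: (nat \<Rightarrow> nat) \<Rightarrow> step list.
    bij_betw f
      {p. p permutes {1..n} \<and> bi_increasing n p \<and> des n p = d \<and> ddes n p = k}
      {w. two_Motzkin_path n w \<and> count_list w Up = d \<and>
          no_broken_step_at_height_0 w \<and> height_sum w = int k}"
    (is "\<exists>f. bij_betw f ?P ?W")
proof (intro exI[of _ "path_of n"], unfold bij_betw_def, intro conjI)
  have av: "avoider n p" if "p \<in> ?P" for p
    using that bi_increasing_iff_avoids_321[of p n] by (simp add: avoider_def)
  show "inj_on (path_of n) ?P"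
  proof (rule inj_onI)
    fix p q assume pq: "p \<in> ?P" "q \<in> ?P" "path_of n p = path_of n q"
    show "p = q"
    \<comment> \<open>Both words are sorted by the key of their common path.\<close>
    proof (rule sorting_permutation_unique)
      show "p permutes {1..n}" "q permutes {1..n}" using pq by auto
      show "strict_mono_on {1..n} (key (path_of n p) \<circ> p)"
        using avoider.strict_mono_on_key_path_of[OF av[OF pq(1)]] .
      show "strict_mono_on {1..n} (key (path_of n p) \<circ> q)"
        using avoider.strict_mono_on_key_path_of[OF av[OF pq(2)]] pq(3) by simp
    qed
  qed
  show "path_of n ` ?P = ?W"
  proof
    show "path_of n ` ?P \<subseteq> ?W"
    proof
      fix w assume "w \<in> path_of n ` ?P"
      then obtain p where p: "p \<in> ?P" "w = path_of n p" by blast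
      interpret avoider n p using av p(1) .
      show "w \<in> ?W"
        using p two_Motzkin_path_path_of count_Up_path_of no_broken_path_of height_sum_path_of
        by simp
    qed
    show "?W \<subseteq> path_of n ` ?P"
    proof
      fix w assume w: "w \<in> ?W"
      then have len: "length w = n" by (simp add: two_Motzkin_path_def)
      \<comment> \<open>The preimage is the word sorted by the key of \<open>w\<close>; once its
        path is known to be \<open>w\<close>, the statistics transfer.\<close>
      obtain p where p: "p permutes {1..n}" "strict_mono_on {1..n} (key w \<circ> p)"
        using sorting_permutation_exists[OF inj_on_key[of w]] len by auto
      interpret motzkin_sorted n w p using w p by unfold_locales auto
      interpret avoider n p using p avoids by unfold_locales
      have "des n p = d" using count_Up_path_of path_of_eq w by simp
      moreover have "ddes n p = k" using height_sum_path_of path_of_eq w by simp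
      moreover have "bi_increasing n p" using bi_increasing_iff_avoids_321[OF p(1)] avoids by simp
      ultimately show "w \<in> path_of n ` ?P" using p(1) path_of_eq by force
    qed
  qed
qed

end
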